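(* Let $D$ be a domain and let $E$ be a nonempty subset of the field of fractions of $D$. If $\mathrm{Int}^{\mathrm{R}}(E,D)$ is a globalized pseudovaluation domain (GPVD), then $D$ is a GPVD.
   Context: Domains are commutative integral domains. For a domain $D$ with field of fractions $K$ and $E\subseteq K$, $\mathrm{Int}^{\mathrm{R}}(E,D)=\{\varphi\in K(x)\mid \varphi(a)\in D \text{ for all } a\in E\}$ is the ring of integer-valued rational functions on $E$ over $D$ (the condition $\varphi(a)\in D$ includes that $\varphi$ is defined at $a$). An extension of commutative rings $A\subseteq B$ is unibranched if the contraction map $\mathrm{Spec}(B)\to\mathrm{Spec}(A)$ is a bijection. A domain $D$ is a globalized pseudovaluation domain (GPVD) if there exists a Prüfer domain $T$ containing $D$ such that (i) $D\subseteq T$ is a unibranched extension, and (ii) there exists a nonzero radical ideal $J$ common to $D$ and $T$ such that each prime ideal of $T$ containing $J$ is maximal in $T$ and each prime ideal of $D$ containing $J$ is maximal in $D$. *)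

theory Defs
  imports "HOL-Algebra.Algebraic_Closure_Type" "HOL-Algebra.Ideal_Product"
    "HOL-Algebra.Subrings" "HOL-Computational_Algebra.Fraction_Field"
begin

text \<open>
  Domains are represented as subrings of an ambient field type, so that the library notions of
  ideal, prime ideal and maximal ideal apply to the record \<open>ring_on D\<close>.
\<close>

abbreviation ring_on :: "'a::field set \<Rightarrow> 'a ring" where
  "ring_on D \<equiv> ring_of_type_algebra\<lparr>carrier := D\<rparr>"

definition Spec :: "'a::field set \<Rightarrow> 'a set set" where
  "Spec D = {P. primeideal P (ring_on D)}"

definition unibranched :: "'a::field set \<Rightarrow> 'a set \<Rightarrow> bool" where
  "unibranched A B \<longleftrightarrow> A \<subseteq> B \<and> bij_betw (\<lambda>P. P \<inter> A) (Spec B) (Spec A)"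

text \<open>
  For a nonzero ideal \<open>I\<close> of \<open>T\<close>, every element of \<open>inverse_ideal T I\<close> is a
  quotient of two elements of \<open>T\<close>. Hence this is the inverse of \<open>I\<close> formed in the
  fraction field of \<open>T\<close>, even if the ambient field is larger.
\<close>

definition inverse_ideal :: "'a::field set \<Rightarrow> 'a set \<Rightarrow> 'a set" where
  "inverse_ideal T I = {x. \<forall>i\<in>I. x * i \<in> T}"

definition invertible_ideal :: "'a::field set \<Rightarrow> 'a set \<Rightarrow> bool" where
  "invertible_ideal T I \<longleftrightarrow> ideal_prod ring_of_type_algebra I (inverse_ideal T I) = T"

definition pruefer_domain :: "'a::field set \<Rightarrow> bool" where
  "pruefer_domain T \<longleftrightarrow> subdomain T ring_of_type_algebra \<and>
     (\<forall>S. finite S \<and> S \<subseteq> T \<and> genideal (ring_on T) S \<noteq> {0} \<longrightarrow>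
        invertible_ideal T (genideal (ring_on T) S))"

text \<open>The unit ideal counts as a radical ideal.\<close>

definition radical_ideal :: "'a::field set \<Rightarrow> 'a set \<Rightarrow> bool" where
  "radical_ideal J D \<longleftrightarrow> ideal J (ring_on D) \<and> (\<forall>x\<in>D. \<forall>n. x ^ n \<in> J \<longrightarrow> x \<in> J)"

text \<open>
  It is no restriction to look for \<open>T\<close> inside the ambient field: if \<open>J\<close> is a common ideal
  and \<open>0 \<noteq> j \<in> J\<close>, then \<open>t = (t * j) / j\<close> with \<open>t * j \<in> J \<subseteq> D\<close> for
  all \<open>t \<in> T\<close>, so any such \<open>T\<close> lies between \<open>D\<close> and the fraction field of \<open>D\<close>.
\<close>

definition gpvd :: "'a::field set \<Rightarrow> bool" where
  "gpvd D \<longleftrightarrow> subdomain D ring_of_type_algebra \<and>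
     (\<exists>T. pruefer_domain T \<and> unibranched D T \<and>
        (\<exists>J. radical_ideal J D \<and> radical_ideal J T \<and> J \<noteq> {0} \<and>
           (\<forall>P. primeideal P (ring_on T) \<and> J \<subseteq> P \<longrightarrow> maximalideal P (ring_on T)) \<and>
           (\<forall>P. primeideal P (ring_on D) \<and> J \<subseteq> P \<longrightarrow> maximalideal P (ring_on D))))"

text \<open>
  \<open>ratfun_value \<phi> a y\<close>: the rational function \<open>\<phi>\<close> is defined at \<open>a\<close> and has
  the value \<open>y\<close> there. The representation of \<open>\<phi>\<close> may be chosen freely, in particular
  in lowest terms, so removable singularities are not poles.
\<close>

definition ratfun_value :: "'k::field poly fract \<Rightarrow> 'k \<Rightarrow> 'k \<Rightarrow> bool" where
  "ratfun_value \<phi> a y \<longleftrightarrow>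
     (\<exists>p q. \<phi> = Fraction_Field.Fract p q \<and> poly q a \<noteq> 0 \<and> y = poly p a / poly q a)"

lemma ratfun_value_unique:
  assumes "ratfun_value \<phi> a y" and "ratfun_value \<phi> a z"
  shows "y = z"
proof -
  obtain p q where 1: "\<phi> = Fraction_Field.Fract p q" "poly q a \<noteq> 0" "y = poly p a / poly q a"
    using assms(1) unfolding ratfun_value_def by blast
  obtain r s where 2: "\<phi> = Fraction_Field.Fract r s" "poly s a \<noteq> 0" "z = poly r a / poly s a"
    using assms(2) unfolding ratfun_value_def by blast
  have "q \<noteq> 0" "s \<noteq> 0" using 1 2 by auto
  then have "p * s = r * q" using 1 2 eq_fract(1) by metis
  then have "poly p a * poly s a = poly r a * poly q a" by (metis poly_mult)
  then show ?thesis using 1 2 by (simp add: frac_eq_eq)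
qed

definition Int_R :: "'k::field set \<Rightarrow> 'k set \<Rightarrow> 'k poly fract set" where
  "Int_R E D = {\<phi>. \<forall>a\<in>E. \<exists>y\<in>D. ratfun_value \<phi> a y}"

end

theory Submission
  imports Defs
begin

text \<open>
  Let \<open>R = Int\<^sup>R(E, D)\<close> be a GPVD with witnesses \<open>T\<close> and \<open>J\<close>, and fix \<open>a \<in> E\<close>.
  Evaluation at \<open>a\<close> maps \<open>R\<close> onto \<open>D\<close>. If it kills \<open>J\<close>, then its kernel is a prime
  ideal containing \<open>J\<close>, hence maximal, and \<open>D\<close> is a field. Otherwise fix \<open>j \<in> J\<close> with
  \<open>j(a) \<noteq> 0\<close>. Every \<open>t \<in> T\<close> is the quotient of \<open>t j \<in> J \<subseteq> R\<close> by \<open>j\<close>, so evaluation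
  extends to \<open>T\<close>, and the images of \<open>T\<close> and \<open>J\<close> are witnesses for \<open>D\<close>. The main point is that
  each prime \<open>P\<close> of \<open>R\<close> containing the kernel on \<open>R\<close> lies under a prime of \<open>T\<close> containing
  the kernel on \<open>T\<close>. If \<open>s \<in> J - P\<close>, the prime over \<open>P\<close> works, because \<open>t s \<in> P\<close> for \<open>t\<close>
  in the kernel. If \<open>J \<subseteq> P\<close>, take a prime of \<open>T\<close> that contains \<open>J\<close> and the kernel and is
  disjoint from \<open>R - P\<close>; its contraction contains \<open>J\<close>, so it is maximal and equals \<open>P\<close>.
\<close>

section \<open>Subrings of a field and elementwise descriptions of their ideals\<close>

lemma ring_of_type_algebra_simps [simp]:
  "carrier ring_of_type_algebra = UNIV"
  "ring.add ring_of_type_algebra = (+)" "monoid.mult ring_of_type_algebra = (*)"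
  "monoid.one ring_of_type_algebra = 1" "ring.zero ring_of_type_algebra = 0"
  by (simp_all add: ring_of_type_algebra_def)

lemma a_inv_ring_of_type_algebra [simp]:
  fixes x :: "'a::field"
  shows "a_inv ring_of_type_algebra x = - x"
proof -
  interpret field "ring_of_type_algebra :: 'a ring"
    by (rule field_from_type_algebra)
  show ?thesis
    using minus_equality[of "- x" x] by simp
qed

lemma subdomain_ring_of_type_algebra_iff:
  fixes A :: "'a::field set"
  shows "subdomain A ring_of_type_algebra \<longleftrightarrow>
    1 \<in> A \<and> (\<forall>x\<in>A. - x \<in> A) \<and> (\<forall>x\<in>A. \<forall>y\<in>A. x + y \<in> A) \<and> (\<forall>x\<in>A. \<forall>y\<in>A. x * y \<in> A)"
proof -
  interpret field "ring_of_type_algebra :: 'a ring"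
    by (rule field_from_type_algebra)
  show ?thesis
  proof
    assume "subdomain A ring_of_type_algebra"
    then show "1 \<in> A \<and> (\<forall>x\<in>A. - x \<in> A) \<and> (\<forall>x\<in>A. \<forall>y\<in>A. x + y \<in> A) \<and> (\<forall>x\<in>A. \<forall>y\<in>A. x * y \<in> A)"
      using subdomainE[of A ring_of_type_algebra] by auto
  next
    assume "1 \<in> A \<and> (\<forall>x\<in>A. - x \<in> A) \<and> (\<forall>x\<in>A. \<forall>y\<in>A. x + y \<in> A) \<and> (\<forall>x\<in>A. \<forall>y\<in>A. x * y \<in> A)"
    then show "subdomain A ring_of_type_algebra"
      by (intro subdomainI' subringI) auto
  qed
qed

locale field_subring =
  fixes A :: "'a::field set"
  assumes subdomain: "subdomain A ring_of_type_algebra"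
begin

lemma one_mem: "1 \<in> A"
  and minus_mem: "x \<in> A \<Longrightarrow> - x \<in> A"
  and add_mem: "x \<in> A \<Longrightarrow> y \<in> A \<Longrightarrow> x + y \<in> A"
  and mult_mem: "x \<in> A \<Longrightarrow> y \<in> A \<Longrightarrow> x * y \<in> A"
  using subdomain by (auto simp: subdomain_ring_of_type_algebra_iff)

lemma zero_mem: "0 \<in> A"
  using add_mem[OF one_mem minus_mem[OF one_mem]] by simp

lemma diff_mem: "x \<in> A \<Longrightarrow> y \<in> A \<Longrightarrow> x - y \<in> A"
  using add_mem[OF _ minus_mem] by fastforce

lemma power_mem: "x \<in> A \<Longrightarrow> x ^ n \<in> A"
  by (induction n) (auto intro: one_mem mult_mem)

lemma cring_ring_on: "cring (ring_on A)"
proof -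
  interpret field "ring_of_type_algebra :: 'a ring"
    by (rule field_from_type_algebra)
  show ?thesis
    using subdomain subcring_iff subdomain.axioms(1) by fastforce
qed

lemma ideal_iff:
  "ideal I (ring_on A) \<longleftrightarrow>
    I \<subseteq> A \<and> 0 \<in> I \<and> (\<forall>x\<in>I. \<forall>y\<in>I. x + y \<in> I) \<and> (\<forall>x\<in>I. \<forall>a\<in>A. a * x \<in> I)"
    (is "_ \<longleftrightarrow> ?R")
proof
  assume "ideal I (ring_on A)"
  then interpret ideal I "ring_on A" .
  show ?R
    using a_subset additive_subgroup.a_closed[OF is_additive_subgroup]
      I_l_closed additive_subgroup.zero_closed[OF is_additive_subgroup] by auto
next
  assume I: ?R
  interpret R: cring "ring_on A"
    by (rule cring_ring_on)
  \<comment> \<open>Closure under negation comes from multiplication by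
    \<open>- 1 \<in> A\<close>.\<close>
  have "- x \<in> I" if "x \<in> I" for x
    using I that minus_mem[OF one_mem] by fastforce
  moreover have "a_inv (ring_on A) x = - x" if "x \<in> A" for x
    using R.minus_equality[of "- x" x] that minus_mem by simp
  ultimately have "subgroup I (add_monoid (ring_on A))"
    using I by (intro R.add.subgroupI) (auto simp: subset_iff simp flip: a_inv_def)
  then show "ideal I (ring_on A)"
    using I by (intro idealI R.ring_axioms) (auto simp: mult.commute)
qed

lemma primeideal_iff:
  "primeideal P (ring_on A) \<longleftrightarrow>
    ideal P (ring_on A) \<and> 1 \<notin> P \<and> (\<forall>x\<in>A. \<forall>y\<in>A. x * y \<in> P \<longrightarrow> x \<in> P \<or> y \<in> P)"
    (is "_ \<longleftrightarrow> ?R")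
proof
  assume "primeideal P (ring_on A)"
  then interpret primeideal P "ring_on A" .
  show ?R
    using I_prime one_imp_carrier I_notcarr ideal_axioms by auto
next
  assume ?R
  then show "primeideal P (ring_on A)"
    using one_mem cring_ring_on by (intro primeidealI) auto
qed

text \<open>The set is \<open>I + x A\<close>, the ideal against which the maximality of
  \<open>I\<close> is tested below.\<close>

lemma ideal_adjoin:
  assumes "ideal I (ring_on A)" and x: "x \<in> A"
  shows "ideal {i + x * u | i u. i \<in> I \<and> u \<in> A} (ring_on A)" (is "ideal ?L _")
  unfolding ideal_iff
proof (intro conjI ballI)
  note I = assms(1)[unfolded ideal_iff]
  show "?L \<subseteq> A"
    using I x by (auto intro!: add_mem mult_mem)
  show "0 \<in> ?L"
    using I zero_mem by force
  show "y + z \<in> ?L" if y: "y \<in> ?L" and z: "z \<in> ?L" for y z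
  proof -
    obtain i u j v where "i \<in> I" "u \<in> A" "j \<in> I" "v \<in> A" "y = i + x * u" "z = j + x * v"
      using y z by auto
    then have "y + z = (i + j) + x * (u + v)" "i + j \<in> I" "u + v \<in> A"
      using I add_mem by (auto simp: algebra_simps)
    then show ?thesis by blast
  qed
  show "a * y \<in> ?L" if y: "y \<in> ?L" and a: "a \<in> A" for y a
  proof -
    obtain i u where "i \<in> I" "u \<in> A" "y = i + x * u"
      using y by auto
    then have "a * y = a * i + x * (a * u)" "a * i \<in> I" "a * u \<in> A"
      using I a mult_mem by (auto simp: algebra_simps)
    then show ?thesis by blast
  qed
qed

text \<open>The right-hand side says that \<open>A/P\<close> is a field. If \<open>P\<close> is
  maximal and \<open>x\<close> lies outside it, then \<open>P + x A\<close> contains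
  \<open>1\<close>; conversely, an ideal strictly above \<open>P\<close> contains an element
  invertible modulo \<open>P\<close>, hence \<open>1\<close>.\<close>

lemma maximalideal_iff:
  "maximalideal P (ring_on A) \<longleftrightarrow>
    ideal P (ring_on A) \<and> 1 \<notin> P \<and> (\<forall>x\<in>A - P. \<exists>u\<in>A. 1 - x * u \<in> P)"
    (is "_ \<longleftrightarrow> ?R")
proof
  assume "maximalideal P (ring_on A)"
  then interpret maximalideal P "ring_on A" .
  note P = ideal_axioms[unfolded ideal_iff]
  have "\<exists>u\<in>A. 1 - x * u \<in> P" if x: "x \<in> A - P" for x
  proof -
    define I where "I = {p + x * u | p u. p \<in> P \<and> u \<in> A}"
    have "ideal I (ring_on A)"
      unfolding I_def using ideal_adjoin[OF ideal_axioms] x by simp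
    moreover have "P \<subseteq> I"
      unfolding I_def using zero_mem by force
    moreover have "x \<in> I"
      unfolding I_def using P one_mem by force
    ultimately have "I = A"
      using I_maximal[of I] x by (auto simp: ideal_iff)
    then obtain p u where "p \<in> P" "u \<in> A" "1 = p + x * u"
      using one_mem unfolding I_def by blast
    then show ?thesis
      by (metis add_diff_cancel_right')
  qed
  moreover have "1 \<notin> P"
    using one_imp_carrier I_notcarr by auto
  ultimately show ?R
    using ideal_axioms by blast
next
  assume r: ?R
  show "maximalideal P (ring_on A)"
  proof (rule maximalidealI)
    show "ideal P (ring_on A)" "carrier (ring_on A) \<noteq> P"
      using r one_mem by auto
    fix I assume I: "ideal I (ring_on A)" "P \<subseteq> I" "I \<subseteq> carrier (ring_on A)"
    show "I = P \<or> I = carrier (ring_on A)"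
    proof (cases "I \<subseteq> P")
      case False
      then obtain x where x: "x \<in> I" "x \<notin> P" by blast
      then have "x \<in> A - P"
        using I by auto
      then obtain u where u: "u \<in> A" "1 - x * u \<in> P"
        using r by blast
      have "(1 - x * u) + u * x \<in> I"
        using I x u unfolding ideal_iff by blast
      then have "1 \<in> I" by (simp add: mult.commute)
      have "a \<in> I" if "a \<in> A" for a
        using I \<open>1 \<in> I\<close> that unfolding ideal_iff by fastforce
      then show ?thesis using I by auto
    qed (use I in auto)
  qed
qed

section \<open>Existence of primes, and von Neumann regularity modulo a radical ideal\<close>

text \<open>Krull's argument: Zorn's lemma gives \<open>P\<close> maximal among the ideals that
  contain \<open>I\<close> and miss \<open>M\<close>. Adjoining an element outside \<open>P\<close>
  produces an ideal that meets \<open>M\<close>, and the product of two such elements of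
  \<open>M\<close> would lie in \<open>P\<close> if \<open>x * y\<close> did.\<close>

lemma exists_prime_disjoint:
  assumes "ideal I (ring_on A)" and "I \<inter> M = {}"
    and M: "1 \<in> M" "\<And>x y. x \<in> M \<Longrightarrow> y \<in> M \<Longrightarrow> x * y \<in> M"
  shows "\<exists>P. primeideal P (ring_on A) \<and> I \<subseteq> P \<and> P \<inter> M = {}"
proof -
  define \<A> where "\<A> = {L. ideal L (ring_on A) \<and> I \<subseteq> L \<and> L \<inter> M = {}}"
  have "\<exists>P\<in>\<A>. \<forall>U\<in>\<A>. P \<subseteq> U \<longrightarrow> U = P"
  proof (rule subset_Zorn_nonempty)
    show "\<A> \<noteq> {}" using assms by (auto simp: \<A>_def)
    fix C assume C: "C \<noteq> {}" "subset.chain \<A> C"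
    then have CA: "C \<subseteq> \<A>" and lin: "\<And>U V. U \<in> C \<Longrightarrow> V \<in> C \<Longrightarrow> U \<subseteq> V \<or> V \<subseteq> U"
      by (auto simp: subset_chain_def)
    have id: "ideal U (ring_on A)" if "U \<in> C" for U
      using CA that by (auto simp: \<A>_def)
    have "ideal (\<Union>C) (ring_on A)"
      unfolding ideal_iff
    proof (intro conjI ballI)
      show "\<Union>C \<subseteq> A" "0 \<in> \<Union>C"
        using id C(1) unfolding ideal_iff by blast+
      show "x + y \<in> \<Union>C" if xy: "x \<in> \<Union>C" "y \<in> \<Union>C" for x y
      proof -
        obtain U V where "U \<in> C" "V \<in> C" "x \<in> U" "y \<in> V"
          using xy by blast
        moreover from this obtain W where "W \<in> C" "x \<in> W" "y \<in> W"
          using lin by blast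
        ultimately show ?thesis
          using id unfolding ideal_iff by blast
      qed
      show "a * x \<in> \<Union>C" if "x \<in> \<Union>C" "a \<in> A" for x a
        using that id unfolding ideal_iff by blast
    qed
    then show "\<Union>C \<in> \<A>"
      using CA C(1) by (auto simp: \<A>_def)
  qed
  then obtain P where P: "ideal P (ring_on A)" "I \<subseteq> P" "P \<inter> M = {}"
    and max: "\<And>L. ideal L (ring_on A) \<Longrightarrow> P \<subseteq> L \<Longrightarrow> L \<inter> M = {} \<Longrightarrow> L = P"
    by (auto simp: \<A>_def)
  note P' = P(1)[unfolded ideal_iff]
  have meets: "\<exists>u\<in>A. \<exists>p\<in>P. p + x * u \<in> M" if x: "x \<in> A" "x \<notin> P" for x
  proof -
    define L where "L = {p + x * u | p u. p \<in> P \<and> u \<in> A}"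
    have "ideal L (ring_on A)"
      unfolding L_def using ideal_adjoin[OF P(1) x(1)] .
    moreover have "P \<subseteq> L"
      unfolding L_def using zero_mem by force
    moreover have "x \<in> L"
      unfolding L_def using P' one_mem by force
    ultimately show ?thesis
      using max[of L] x unfolding L_def by blast
  qed
  have "x \<in> P \<or> y \<in> P" if xy: "x \<in> A" "y \<in> A" "x * y \<in> P" for x y
  proof (rule ccontr)
    assume "\<not> (x \<in> P \<or> y \<in> P)"
    then obtain u p v q where *: "u \<in> A" "v \<in> A" "p \<in> P" "q \<in> P" "p + x * u \<in> M" "q + y * v \<in> M"
      using meets[of x] meets[of y] xy by blast
    \<comment> \<open>This is the product of the two elements of \<open>M\<close>, grouped so that
      each summand has a factor \<open>p\<close>, \<open>q\<close> or \<open>x * y\<close> in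
      \<open>P\<close>.\<close>
    have "(q + y * v) * p + (x * u) * q + (u * v) * (x * y) \<in> P"
      using * xy P' by (meson add_mem mult_mem subsetD)
    then have "(p + x * u) * (q + y * v) \<in> P"
      by (simp add: algebra_simps)
    then show False
      using M(2) * P(3) by blast
  qed
  then have "primeideal P (ring_on A)"
    unfolding primeideal_iff using P M(1) by blast
  then show ?thesis
    using P by blast
qed

lemma primeideal_contract:
  assumes P: "primeideal P (ring_on A)" and B: "subdomain B ring_of_type_algebra" "B \<subseteq> A"
  shows "primeideal (P \<inter> B) (ring_on B)"
proof -
  interpret B: field_subring B
    by (rule field_subring.intro) (rule B)
  show ?thesis
    using P B(2) unfolding primeideal_iff B.primeideal_iff ideal_iff B.ideal_iff
    by (auto simp: B.zero_mem B.add_mem B.mult_mem subset_iff)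
qed

text \<open>In other words, \<open>A/J\<close> is von Neumann regular, being reduced and zero-dimensional.\<close>

lemma exists_regular_mod:
  assumes J: "radical_ideal J A"
    and max: "\<And>P. primeideal P (ring_on A) \<Longrightarrow> J \<subseteq> P \<Longrightarrow> maximalideal P (ring_on A)"
    and t: "t \<in> A"
  shows "\<exists>u\<in>A. t * (1 - t * u) \<in> J"
proof -
  \<comment> \<open>A prime that misses \<open>M\<close> contains neither \<open>t\<close> nor any
    \<open>1 - t * u\<close>, so \<open>t\<close> is a nonzero nonunit modulo it and the prime is
    not maximal.\<close>
  define M where "M = {t ^ n * (1 - t * u) | n u. u \<in> A}"
  have MI: "t ^ n * (1 - t * u) \<in> M" if "u \<in> A" for n u
    using that unfolding M_def by blast
  have "J \<inter> M \<noteq> {}"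
  proof
    assume disj: "J \<inter> M = {}"
    have "1 \<in> M"
      using MI[OF zero_mem, of 0] by simp
    moreover have "x * y \<in> M" if xy: "x \<in> M" "y \<in> M" for x y
    proof -
      obtain n u m v where *: "u \<in> A" "v \<in> A" "x = t ^ n * (1 - t * u)" "y = t ^ m * (1 - t * v)"
        using xy unfolding M_def by blast
      have "x * y = t ^ (n + m) * (1 - t * (u + v - t * (u * v)))"
        unfolding *(3,4) by (simp add: power_add algebra_simps)
      moreover have "u + v - t * (u * v) \<in> A"
        using * t by (intro diff_mem add_mem mult_mem)
      ultimately show ?thesis
        using MI by simp
    qed
    ultimately obtain P where P: "primeideal P (ring_on A)" "J \<subseteq> P" "P \<inter> M = {}"
      using exists_prime_disjoint[of J M] J disj unfolding radical_ideal_def by blast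
    have "t \<in> M"
      using MI[OF zero_mem, of 1] by simp
    then obtain u where "u \<in> A" "1 - t * u \<in> P"
      using max[OF P(1,2)] P(3) t unfolding maximalideal_iff by blast
    then show False
      using MI[of u 0] P(3) by auto
  qed
  then obtain n u where u: "u \<in> A" "t ^ n * (1 - t * u) \<in> J"
    unfolding M_def by blast
  let ?s = "1 - t * u"
  have s: "?s \<in> A"
    using u t by (intro diff_mem one_mem mult_mem)
  \<comment> \<open>The extra factor completes the element of \<open>J\<close> to a power of
    \<open>t * ?s\<close>, to which radicality applies.\<close>
  have "(t * ?s ^ n) * (t ^ n * ?s) \<in> J"
    using J u t s power_mem mult_mem unfolding radical_ideal_def ideal_iff by blast
  also have "(t * ?s ^ n) * (t ^ n * ?s) = (t * ?s) ^ Suc n"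
    by (simp add: power_mult_distrib)
  finally show ?thesis
    using J u s t mult_mem unfolding radical_ideal_def by blast
qed

text \<open>Modulo \<open>I\<close>, \<open>reg\<close> reads \<open>y = u * y ^ 2\<close>, hence
  \<open>y ^ n = u * y ^ Suc n\<close> for positive \<open>n\<close>, and the exponent can be
  lowered to 1. This will show that the image of \<open>J\<close> is again radical.\<close>

lemma mem_ideal_if_regular_power:
  assumes "ideal I (ring_on A)" and y: "y \<in> A" and "u \<in> A"
    and reg: "y * (1 - y * u) \<in> I" and "y ^ n \<in> I"
  shows "y \<in> I"
  using \<open>y ^ n \<in> I\<close>
proof (induction n)
  case 0
  then have "y * 1 \<in> I"
    using assms(1) y unfolding ideal_iff by fastforce
  then show ?case by simp
next
  case (Suc n)
  show ?case
  proof (cases n)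
    case 0
    then show ?thesis using Suc.prems by simp
  next
    case (Suc m)
    have "y ^ m * (y * (1 - y * u)) + u * y ^ Suc n \<in> I"
      using assms Suc.prems power_mem[OF y] unfolding ideal_iff by blast
    also have "y ^ m * (y * (1 - y * u)) + u * y ^ Suc n = y ^ n"
      using Suc by (simp add: algebra_simps)
    finally show ?thesis
      by (rule Suc.IH)
  qed
qed

end

section \<open>Ring homomorphisms from a subring of a field into another field\<close>

text \<open>\<open>f\<close> is a total function but respects the operations only on
  \<open>A\<close>, because evaluation at a point is meaningful only for functions without a pole
  there.\<close>

locale field_subring_hom = field_subring A for A :: "'a::field set" +
  fixes f :: "'a \<Rightarrow> 'b::field"
  assumes hom_one: "f 1 = 1"
    and hom_add: "x \<in> A \<Longrightarrow> y \<in> A \<Longrightarrow> f (x + y) = f x + f y"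
    and hom_mult: "x \<in> A \<Longrightarrow> y \<in> A \<Longrightarrow> f (x * y) = f x * f y"
begin

lemma hom_zero: "f 0 = 0"
  using hom_add[OF zero_mem zero_mem] by (metis add.right_neutral add_left_cancel)

lemma hom_minus: "x \<in> A \<Longrightarrow> f (- x) = - f x"
  using hom_add[of x "- x"] minus_mem[of x] hom_zero by (simp add: eq_neg_iff_add_eq_0 add.commute)

lemma hom_diff: "x \<in> A \<Longrightarrow> y \<in> A \<Longrightarrow> f (x - y) = f x - f y"
  using hom_add[of x "- y"] minus_mem[of y] hom_minus by simp

lemma hom_subset:
  assumes "subdomain B ring_of_type_algebra" and "B \<subseteq> A"
  shows "field_subring_hom B f"
  using assms hom_one hom_add hom_mult
  by (intro field_subring_hom.intro field_subring.intro field_subring_hom_axioms.intro) (auto simp: subset_iff)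

lemma subdomain_image: "subdomain (f ` A) ring_of_type_algebra"
proof -
  have "1 \<in> f ` A"
    using one_mem hom_one by force
  moreover have "- f x \<in> f ` A" if "x \<in> A" for x
    using that hom_minus[of x] minus_mem by (metis image_eqI)
  moreover have "f x + f y \<in> f ` A" if "x \<in> A" "y \<in> A" for x y
    using that hom_add[of x y] add_mem by (metis image_eqI)
  moreover have "f x * f y \<in> f ` A" if "x \<in> A" "y \<in> A" for x y
    using that hom_mult[of x y] mult_mem by (metis image_eqI)
  ultimately show ?thesis
    by (auto simp: subdomain_ring_of_type_algebra_iff)
qed

sublocale image: field_subring "f ` A"
  by (rule field_subring.intro) (rule subdomain_image)

lemma ideal_image:
  assumes "ideal I (ring_on A)"
  shows "ideal (f ` I) (ring_on (f ` A))"
proof -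
  note I = assms[unfolded ideal_iff]
  have "0 \<in> f ` I"
    using I hom_zero by force
  moreover have "f x + f y \<in> f ` I" if "x \<in> I" "y \<in> I" for x y
    using that I hom_add[of x y] by (metis image_eqI subsetD)
  moreover have "f a * f x \<in> f ` I" if "x \<in> I" "a \<in> A" for x a
    using that I hom_mult[of a x] by (metis image_eqI subsetD)
  ultimately show ?thesis
    using I unfolding image.ideal_iff by auto
qed

lemma ideal_preimage:
  assumes "ideal I (ring_on (f ` A))"
  shows "ideal {x \<in> A. f x \<in> I} (ring_on A)"
  using assms unfolding ideal_iff image.ideal_iff
  by (auto simp: hom_zero hom_add hom_mult zero_mem add_mem mult_mem)

lemma primeideal_preimage:
  assumes "primeideal P (ring_on (f ` A))"
  shows "primeideal {x \<in> A. f x \<in> P} (ring_on A)"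
  using assms ideal_preimage[of P] unfolding primeideal_iff image.primeideal_iff
  by (auto simp: hom_one hom_mult)

text \<open>Two elements of \<open>A\<close> with the same image differ by an element of the kernel,
  which lies in \<open>I\<close>.\<close>

lemma hom_mem_image_iff:
  assumes "ideal I (ring_on A)" and ker: "\<And>x. x \<in> A \<Longrightarrow> f x = 0 \<Longrightarrow> x \<in> I" and x: "x \<in> A"
  shows "f x \<in> f ` I \<longleftrightarrow> x \<in> I"
proof
  assume "f x \<in> f ` I"
  then obtain y where y: "y \<in> I" "f x = f y" by blast
  have yA: "y \<in> A"
    using y assms(1) unfolding ideal_iff by blast
  have "f (x - y) = 0"
    using hom_diff[of x y] x y yA by simp
  then have "x - y \<in> I"
    using ker diff_mem x yA by blast
  then have "(x - y) + y \<in> I"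
    using y assms(1) unfolding ideal_iff by blast
  then show "x \<in> I" by simp
qed simp

text \<open>As \<open>P\<close> contains the kernel, membership in its image can be tested before
  applying \<open>f\<close>, where primality of \<open>P\<close> is available.\<close>

lemma primeideal_image:
  assumes P: "primeideal P (ring_on A)" and ker: "\<And>x. x \<in> A \<Longrightarrow> f x = 0 \<Longrightarrow> x \<in> P"
  shows "primeideal (f ` P) (ring_on (f ` A))"
proof -
  note P' = P[unfolded primeideal_iff]
  have mem_iff: "f x \<in> f ` P \<longleftrightarrow> x \<in> P" if "x \<in> A" for x
    using hom_mem_image_iff[of P x] P' ker that by blast
  have "1 \<notin> f ` P"
    using mem_iff[OF one_mem] P' hom_one by simp
  moreover have "f x \<in> f ` P \<or> f y \<in> f ` P"
    if "x \<in> A" "y \<in> A" "f x * f y \<in> f ` P" for x y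
  proof -
    have "x * y \<in> P"
      using that mem_iff[OF mult_mem[of x y]] hom_mult[of x y] by simp
    then show ?thesis
      using P' that(1,2) by blast
  qed
  ultimately show ?thesis
    unfolding image.primeideal_iff using ideal_image P' by auto
qed

text \<open>An inverse of \<open>x\<close> modulo the preimage is mapped to an inverse of
  \<open>f x\<close> modulo \<open>P\<close>.\<close>

lemma maximalideal_of_preimage:
  assumes P: "primeideal P (ring_on (f ` A))"
    and max: "maximalideal {x \<in> A. f x \<in> P} (ring_on A)"
  shows "maximalideal P (ring_on (f ` A))"
proof -
  have "\<exists>u\<in>A. 1 - f x * f u \<in> P" if "x \<in> A" "f x \<notin> P" for x
  proof -
    have "x \<in> A - {x \<in> A. f x \<in> P}"
      using that by simp
    then obtain u where u: "u \<in> A" "f (1 - x * u) \<in> P"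
      using max unfolding maximalideal_iff by blast
    have "f (1 - x * u) = 1 - f x * f u"
      using that(1) u(1) by (simp add: hom_diff hom_mult hom_one one_mem mult_mem)
    then show ?thesis
      using u by (intro bexI[of _ u]) simp_all
  qed
  then show ?thesis
    using P unfolding image.maximalideal_iff image.primeideal_iff by auto
qed

section \<open>Generated ideals, invertibility and the Pruefer property under a homomorphism\<close>

text \<open>Both inclusions use minimality: the image of the ideal generated by \<open>S\<close> is
  an ideal, and so is the preimage of the ideal generated by the image of \<open>S\<close>.\<close>

lemma genideal_image:
  assumes "S \<subseteq> A"
  shows "genideal (ring_on (f ` A)) (f ` S) = f ` genideal (ring_on A) S"
proof
  interpret R: cring "ring_on A"
    by (rule cring_ring_on)
  interpret R': cring "ring_on (f ` A)"
    by (rule image.cring_ring_on)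
  have S: "ideal (genideal (ring_on A) S) (ring_on A)" "S \<subseteq> genideal (ring_on A) S"
    using R.genideal_ideal[of S] R.genideal_self[of S] assms by auto
  show "genideal (ring_on (f ` A)) (f ` S) \<subseteq> f ` genideal (ring_on A) S"
    using S by (intro R'.genideal_minimal ideal_image image_mono)
  have fS: "ideal (genideal (ring_on (f ` A)) (f ` S)) (ring_on (f ` A))"
    "f ` S \<subseteq> genideal (ring_on (f ` A)) (f ` S)"
    using R'.genideal_ideal[of "f ` S"] R'.genideal_self[of "f ` S"] assms by auto
  have "genideal (ring_on A) S \<subseteq> {x \<in> A. f x \<in> genideal (ring_on (f ` A)) (f ` S)}"
    using fS assms by (intro R.genideal_minimal ideal_preimage) auto
  then show "f ` genideal (ring_on A) S \<subseteq> genideal (ring_on (f ` A)) (f ` S)"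
    by blast
qed

text \<open>Multiplication by an element \<open>x\<close> of the inverse ideal maps \<open>I\<close>
  into \<open>A\<close>. Some \<open>s \<in> I\<close> has \<open>f s \<noteq> 0\<close>, and
  dividing by \<open>f s\<close> gives an element that acts on the image of \<open>I\<close> in the
  corresponding way. So \<open>f\<close> carries the product of \<open>I\<close> and its inverse,
  which is \<open>A\<close>, into the product formed in the image.\<close>

lemma invertible_ideal_image:
  assumes I: "ideal I (ring_on A)" "invertible_ideal A I" and "f ` I \<noteq> {0}"
  shows "invertible_ideal (f ` A) (f ` I)"
proof -
  note I' = I(1)[unfolded ideal_iff]
  have "f 0 \<in> f ` I"
    using I' by blast
  then obtain s where s: "s \<in> I" "f s \<noteq> 0"
    using assms(3) hom_zero by auto
  have s': "s \<in> A" using s I' by blast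
  let ?J = "ideal_prod ring_of_type_algebra (f ` I) (inverse_ideal (f ` A) (f ` I))"
  \<comment> \<open>The conjunct \<open>z \<in> A\<close> is carried along so that \<open>f\<close>
    is additive in the \<open>sum\<close> case.\<close>
  have in_prod: "z \<in> A \<and> f z \<in> ?J" if "z \<in> ideal_prod ring_of_type_algebra I (inverse_ideal A I)" for z
    using that
  proof (induction rule: ideal_prod.induct)
    case (prod i x)
    have xI: "x * k \<in> A" if "k \<in> I" for k
      using prod(2) that by (simp add: inverse_ideal_def)
    \<comment> \<open>\<open>x\<close> need not lie in \<open>A\<close>; this is the value at \<open>x\<close> of the extension of \<open>f\<close>
      to the localization of \<open>A\<close> at the kernel.\<close>
    define y where "y = f (x * s) / f s"
    have y: "y * f k = f (x * k)" if "k \<in> I" for k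
    proof -
      \<comment> \<open>\<open>x * s\<close> and \<open>x * k\<close> lie in \<open>A\<close>, so
        the product of \<open>x\<close>, \<open>s\<close> and \<open>k\<close> factors inside
        \<open>A\<close> in two ways.\<close>
      have "f (x * s) * f k = f ((x * s) * k)"
        using hom_mult[OF xI[OF s(1)], of k] that I' by (simp add: subset_iff)
      also have "(x * s) * k = (x * k) * s"
        by simp
      also have "f \<dots> = f (x * k) * f s"
        using hom_mult[OF xI[OF that] s'] .
      finally show ?thesis
        using s by (simp add: y_def field_simps)
    qed
    have "y \<in> inverse_ideal (f ` A) (f ` I)"
      using y xI by (auto simp: inverse_ideal_def)
    then have "f i * y \<in> ?J"
      using ideal_prod.prod[of "f i" "f ` I" y _ ring_of_type_algebra] prod(1) by simp
    then show ?case
      using y[OF prod(1)] xI[OF prod(1)] by (simp add: ac_simps)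
  next
    case (sum z w)
    then show ?case
      using ideal_prod.sum[of "f z" ring_of_type_algebra _ _ "f w"] by (simp add: add_mem hom_add)
  qed
  have "z \<in> f ` A" if "z \<in> ?J" for z
    using that
  proof (induction rule: ideal_prod.induct)
    case (prod i x)
    then have "x * i \<in> f ` A"
      unfolding inverse_ideal_def by blast
    then show ?case
      by (simp add: ac_simps)
  qed (simp add: image.add_mem)
  moreover have "f ` A \<subseteq> ?J"
    using in_prod I(2) unfolding invertible_ideal_def by auto
  ultimately show ?thesis
    unfolding invertible_ideal_def by blast
qed

text \<open>Finitely many generators lift to \<open>A\<close>; the ideal generated by the lifts is
  nonzero because its image is, so it is invertible, and invertibility passes to the image.\<close>

lemma pruefer_domain_image:
  assumes "pruefer_domain A"
  shows "pruefer_domain (f ` A)"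
  unfolding pruefer_domain_def
proof (intro conjI allI impI subdomain_image)
  interpret R: cring "ring_on A"
    by (rule cring_ring_on)
  fix S assume S: "finite S \<and> S \<subseteq> f ` A \<and> genideal (ring_on (f ` A)) S \<noteq> {0}"
  then obtain S' where S': "finite S'" "S' \<subseteq> A" "S = f ` S'"
    by (meson finite_subset_image)
  then have "genideal (ring_on A) S' \<noteq> {0}"
    using S genideal_image[of S'] hom_zero by auto
  then show "invertible_ideal (f ` A) (genideal (ring_on (f ` A)) S)"
    using S S' assms genideal_image[of S'] R.genideal_ideal[of S']
    by (simp add: pruefer_domain_def invertible_ideal_image)
qed

end

section \<open>Passage of the GPVD property to a homomorphic image\<close>

text \<open>This gives surjectivity on spectra for the images of \<open>R\<close> and
  \<open>T\<close>: a prime of \<open>T\<close> has a prime image once it contains the kernel of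
  \<open>f\<close>.\<close>

lemma field_subring_hom_exists_prime_over:
  fixes f :: "'a::field \<Rightarrow> 'b::field"
  assumes "field_subring_hom T f" and "subdomain R ring_of_type_algebra"
    and unibr: "unibranched R T"
    and JR: "ideal J (ring_on R)" and JT: "ideal J (ring_on T)"
    and max: "\<And>P. primeideal P (ring_on R) \<Longrightarrow> J \<subseteq> P \<Longrightarrow> maximalideal P (ring_on R)"
    and P: "primeideal P (ring_on R)" and ker: "\<And>r. r \<in> R \<Longrightarrow> f r = 0 \<Longrightarrow> r \<in> P"
  shows "\<exists>Q. primeideal Q (ring_on T) \<and> Q \<inter> R = P \<and> (\<forall>t\<in>T. f t = 0 \<longrightarrow> t \<in> Q)"
proof -
  interpret T: field_subring_hom T f by fact
  have RT: "R \<subseteq> T"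
    using unibr unfolding unibranched_def by blast
  interpret R: field_subring_hom R f
    using assms(2) RT by (rule T.hom_subset)
  show ?thesis
  proof (cases "J \<subseteq> P")
    case False
    then obtain s where s: "s \<in> J" "s \<notin> P" by blast
    have "P \<in> (\<lambda>Q. Q \<inter> R) ` Spec T"
      using unibr P unfolding unibranched_def bij_betw_def Spec_def by blast
    then obtain Q where Q: "primeideal Q (ring_on T)" "Q \<inter> R = P"
      unfolding Spec_def by blast
    have sR: "s \<in> R" and sT: "s \<in> T"
      using s JR RT unfolding R.ideal_iff by blast+
    have "t \<in> Q" if t: "t \<in> T" "f t = 0" for t
    proof -
      \<comment> \<open>Multiplication by \<open>s\<close> moves the kernel element \<open>t\<close>
        into \<open>R\<close>, where \<open>ker\<close> applies; as \<open>s\<close> is not in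
        \<open>Q\<close>, it can be cancelled afterwards.\<close>
      have "t * s \<in> J"
        using JT s t unfolding T.ideal_iff by blast
      then have "t * s \<in> R"
        using JR unfolding R.ideal_iff by blast
      moreover have "f (t * s) = 0"
        using t sT by (simp add: T.hom_mult)
      ultimately have "t * s \<in> Q"
        using ker Q(2) by blast
      then show ?thesis
        using Q s sR sT t unfolding T.primeideal_iff by blast
    qed
    then show ?thesis
      using Q by blast
  next
    case True
    \<comment> \<open>the sum of \<open>J\<close> and the kernel of \<open>f\<close> on \<open>T\<close>\<close>
    define I where "I = {t \<in> T. f t \<in> f ` J}"
    have I: "ideal I (ring_on T)"
      unfolding I_def using JT by (intro T.ideal_preimage T.ideal_image)
    have "t \<in> P" if t: "t \<in> I" "t \<in> R" for t
    \<comment> \<open>\<open>t\<close> and \<open>j\<close> differ by a kernel element in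
      \<open>R\<close>, which lies in \<open>P\<close>, and \<open>j\<close> itself lies in
      \<open>P\<close>.\<close>
    proof -
      obtain j where j: "j \<in> J" "f t = f j"
        using t unfolding I_def by blast
      have jR: "j \<in> R"
        using j JR unfolding R.ideal_iff by blast
      then have "t - j \<in> P"
        using ker[of "t - j"] R.hom_diff[of t j] R.diff_mem j t by simp
      then have "(t - j) + j \<in> P"
        using j True P unfolding R.primeideal_iff R.ideal_iff by blast
      then show ?thesis by simp
    qed
    then have "I \<inter> (R - P) = {}" by blast
    then obtain Q where Q: "primeideal Q (ring_on T)" "I \<subseteq> Q" "Q \<inter> (R - P) = {}"
      using T.exists_prime_disjoint[OF I, of "R - P"] P R.one_mem R.mult_mem
      unfolding R.primeideal_iff by blast
    have prime: "primeideal (Q \<inter> R) (ring_on R)"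
      using Q(1) assms(2) RT by (rule T.primeideal_contract)
    have "J \<subseteq> I"
      using JT unfolding I_def T.ideal_iff by blast
    then have "J \<subseteq> Q \<inter> R"
      using Q(2) JR unfolding R.ideal_iff by blast
    then interpret maximalideal "Q \<inter> R" "ring_on R"
      by (rule max[OF prime])
    have "P \<subseteq> R" "P \<noteq> R"
      using P R.one_mem unfolding R.primeideal_iff R.ideal_iff by blast+
    \<comment> \<open>Disjointness from \<open>R - P\<close> gives
      \<open>Q \<inter> R \<subseteq> P\<close>, and a maximal ideal inside the proper ideal
      \<open>P\<close> equals \<open>P\<close>.\<close>
    then have "Q \<inter> R = P"
      using I_maximal[of P] P Q(3) unfolding R.primeideal_iff by auto
    moreover have "\<forall>t\<in>T. f t = 0 \<longrightarrow> t \<in> Q"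
      using Q(2) JT T.hom_zero unfolding I_def T.ideal_iff by force
    ultimately show ?thesis
      using Q(1) by blast
  qed
qed

text \<open>The images of \<open>T\<close> and \<open>J\<close> are the witnesses, and
  \<open>j\<close> keeps the image of \<open>J\<close> nonzero. A prime containing the image of
  \<open>J\<close> has a preimage containing \<open>J\<close>, so its maximality is
  inherited.\<close>

lemma field_subring_hom_gpvd_image:
  fixes f :: "'a::field \<Rightarrow> 'b::field"
  assumes "field_subring_hom T f" and R: "subdomain R ring_of_type_algebra"
    and "pruefer_domain T" and unibr: "unibranched R T"
    and JR: "radical_ideal J R" and JT: "radical_ideal J T"
    and maxT: "\<And>P. primeideal P (ring_on T) \<Longrightarrow> J \<subseteq> P \<Longrightarrow> maximalideal P (ring_on T)"
    and maxR: "\<And>P. primeideal P (ring_on R) \<Longrightarrow> J \<subseteq> P \<Longrightarrow> maximalideal P (ring_on R)"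
    and j: "j \<in> J" "f j \<noteq> 0"
  shows "gpvd (f ` R)"
proof -
  interpret T: field_subring_hom T f by fact
  have RT: "R \<subseteq> T"
    using unibr unfolding unibranched_def by blast
  interpret R: field_subring_hom R f
    using R RT by (rule T.hom_subset)
  have idJR: "ideal J (ring_on R)" and idJT: "ideal J (ring_on T)"
    using JR JT by (auto simp: radical_ideal_def)
  have JsubR: "J \<subseteq> R" and JsubT: "J \<subseteq> T"
    using idJR idJT unfolding R.ideal_iff T.ideal_iff by auto
  have fRT: "f ` R \<subseteq> f ` T"
    using RT by blast
  have unibr': "unibranched (f ` R) (f ` T)"
    unfolding unibranched_def
  proof (intro conjI fRT bij_betwI')
    fix P assume "P \<in> Spec (f ` T)"
    then show "P \<inter> f ` R \<in> Spec (f ` R)"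
      using T.image.primeideal_contract[OF _ R.subdomain_image fRT] by (simp add: Spec_def)
  next
    fix P Q assume "P \<in> Spec (f ` T)" "Q \<in> Spec (f ` T)"
    then have PQ: "primeideal P (ring_on (f ` T))" "primeideal Q (ring_on (f ` T))"
      by (auto simp: Spec_def)
    show "P \<inter> f ` R = Q \<inter> f ` R \<longleftrightarrow> P = Q"
    proof
      assume "P \<inter> f ` R = Q \<inter> f ` R"
      \<comment> \<open>Injectivity is pulled back: the preimages in \<open>T\<close> have the same
        contraction to \<open>R\<close>, hence coincide, and a subset of the image of
        \<open>T\<close> is determined by its preimage.\<close>
      then have "{t \<in> T. f t \<in> P} \<inter> R = {t \<in> T. f t \<in> Q} \<inter> R"
        by blast
      moreover have "inj_on (\<lambda>P. P \<inter> R) (Spec T)"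
        using unibr unfolding unibranched_def bij_betw_def by blast
      moreover have "{t \<in> T. f t \<in> P} \<in> Spec T" "{t \<in> T. f t \<in> Q} \<in> Spec T"
        using PQ T.primeideal_preimage by (auto simp: Spec_def)
      ultimately have eq: "{t \<in> T. f t \<in> P} = {t \<in> T. f t \<in> Q}"
        unfolding inj_on_def by blast
      have "P \<subseteq> f ` T" "Q \<subseteq> f ` T"
        using PQ unfolding T.image.primeideal_iff T.image.ideal_iff by auto
      then show "P = Q"
        using eq by blast
    qed simp
  next
    fix P assume "P \<in> Spec (f ` R)"
    then have P: "primeideal P (ring_on (f ` R))"
      by (simp add: Spec_def)
    then have zero: "0 \<in> P" and sub: "P \<subseteq> f ` R"
      unfolding R.image.primeideal_iff R.image.ideal_iff by auto
    \<comment> \<open>Since \<open>0 \<in> P\<close>, the preimage of \<open>P\<close> in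
      \<open>R\<close> contains the kernel on \<open>R\<close>. The image of \<open>Q\<close> will
      be the prime over \<open>P\<close>.\<close>
    obtain Q where Q: "primeideal Q (ring_on T)" "Q \<inter> R = {r \<in> R. f r \<in> P}"
      "\<And>t. t \<in> T \<Longrightarrow> f t = 0 \<Longrightarrow> t \<in> Q"
      using field_subring_hom_exists_prime_over[OF assms(1) R unibr idJR idJT maxR
          R.primeideal_preimage[OF P]] zero by auto
    have idQ: "ideal Q (ring_on T)"
      using Q(1) unfolding T.primeideal_iff by blast
    have mem_iff: "f r \<in> f ` Q \<longleftrightarrow> f r \<in> P" if "r \<in> R" for r
    proof -
      have "f r \<in> f ` Q \<longleftrightarrow> r \<in> Q"
        using idQ Q(3) by (rule T.hom_mem_image_iff) (use that RT in auto)
      then show ?thesis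
        using Q(2) that by auto
    qed
    have "P = f ` Q \<inter> f ` R"
    proof (intro equalityI subsetI)
      show "x \<in> f ` Q \<inter> f ` R" if "x \<in> P" for x
        using that sub mem_iff by blast
      show "x \<in> P" if x: "x \<in> f ` Q \<inter> f ` R" for x
      proof -
        obtain r where "r \<in> R" "x = f r" "x \<in> f ` Q"
          using x by blast
        then show ?thesis
          using mem_iff by simp
      qed
    qed
    moreover have "f ` Q \<in> Spec (f ` T)"
      using T.primeideal_image[OF Q(1,3)] by (simp add: Spec_def)
    ultimately show "\<exists>Q\<in>Spec (f ` T). P = Q \<inter> f ` R"
      by blast
  qed
  have fJT: "ideal (f ` J) (ring_on (f ` T))" and fJR: "ideal (f ` J) (ring_on (f ` R))"
    using T.ideal_image[OF idJT] R.ideal_image[OF idJR] .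
  \<comment> \<open>The image of a radical ideal may fail to be radical in general. Here the
    relation \<open>t * (1 - t * u) \<in> J\<close> survives under \<open>f\<close> and forces
    radicality; the result for \<open>T\<close> restricts to \<open>R\<close>.\<close>
  have rad: "f t \<in> f ` J" if t: "t \<in> T" and n: "f t ^ n \<in> f ` J" for t n
  proof -
    obtain u where u: "u \<in> T" "t * (1 - t * u) \<in> J"
      using T.exists_regular_mod[OF JT maxT t] by blast
    have "f (t * (1 - t * u)) = f t * (1 - f t * f u)"
      using u t by (simp add: T.hom_mult T.hom_diff T.hom_one T.one_mem T.mult_mem T.diff_mem)
    then have "f t * (1 - f t * f u) \<in> f ` J"
      using u(2) by (metis image_eqI)
    then show ?thesis
      using T.image.mem_ideal_if_regular_power[OF fJT _ _ _ n] t u(1) by blast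
  qed
  have "radical_ideal (f ` J) (f ` T)" "radical_ideal (f ` J) (f ` R)"
    using fJT fJR rad RT by (auto simp: radical_ideal_def)
  moreover have "f ` J \<noteq> {0}"
    using j by auto
  moreover have "maximalideal P (ring_on (f ` T))"
    if "primeideal P (ring_on (f ` T))" "f ` J \<subseteq> P" for P
    using that JsubT by (intro T.maximalideal_of_preimage maxT T.primeideal_preimage) auto
  moreover have "maximalideal P (ring_on (f ` R))"
    if "primeideal P (ring_on (f ` R))" "f ` J \<subseteq> P" for P
    using that JsubR by (intro R.maximalideal_of_preimage maxR R.primeideal_preimage) auto
  ultimately show ?thesis
    unfolding gpvd_def
    using R.subdomain_image T.pruefer_domain_image[OF assms(3)] unibr' by blast
qed

section \<open>Fields as GPVDs\<close>

text \<open>Take \<open>T = J = F\<close>. A nonzero ideal contains \<open>1\<close>, so it is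
  invertible, and no prime contains the unit ideal \<open>J\<close>, so the maximality conditions
  hold vacuously.\<close>

lemma gpvd_subfield:
  fixes F :: "'a::field set"
  assumes F: "subdomain F ring_of_type_algebra" and inv: "\<And>x. x \<in> F \<Longrightarrow> inverse x \<in> F"
  shows "gpvd F"
proof -
  interpret field_subring F
    by (rule field_subring.intro) (rule F)
  interpret R: cring "ring_on F"
    by (rule cring_ring_on)
  have "invertible_ideal F I" if I: "ideal I (ring_on F)" "I \<noteq> {0}" for I
  proof -
    note I' = I(1)[unfolded ideal_iff]
    obtain i where i: "i \<in> I" "i \<noteq> 0"
      using I(2) I' by blast
    have "inverse i * i \<in> I"
      using i I' inv by blast
    then have one: "1 \<in> I"
      using i by simp
    have "z \<in> ideal_prod ring_of_type_algebra I (inverse_ideal F I)" if "z \<in> F" for z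
    proof -
      have "z \<in> inverse_ideal F I"
        using that I' mult_mem unfolding inverse_ideal_def by blast
      then show ?thesis
        using ideal_prod.prod[OF one, of z _ ring_of_type_algebra] by simp
    qed
    moreover have "z \<in> F" if "z \<in> ideal_prod ring_of_type_algebra I (inverse_ideal F I)" for z
      using that
    proof (induction rule: ideal_prod.induct)
      case (prod i x)
      then have "x * i \<in> F"
        unfolding inverse_ideal_def by blast
      then show ?case
        by (simp add: ac_simps)
    qed (simp add: add_mem)
    ultimately show ?thesis
      unfolding invertible_ideal_def by blast
  qed
  then have "pruefer_domain F"
    using F R.genideal_ideal by (auto simp: pruefer_domain_def)
  moreover have "P \<inter> F = P" if "P \<in> Spec F" for P
    using that unfolding Spec_def primeideal_iff ideal_iff by blast
  then have "unibranched F F"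
    unfolding unibranched_def bij_betw_def inj_on_def by auto
  moreover have "radical_ideal F F"
    using zero_mem add_mem mult_mem unfolding radical_ideal_def ideal_iff by blast
  moreover have "F \<noteq> {0}"
    using one_mem by auto
  moreover have "\<not> F \<subseteq> P" if "primeideal P (ring_on F)" for P
    using that one_mem unfolding primeideal_iff by blast
  ultimately show ?thesis
    unfolding gpvd_def using F by blast
qed

section \<open>Evaluation of rational functions at a point\<close>

lemma ratfun_value_const: "ratfun_value (Fraction_Field.Fract [:c:] 1) a c"
  unfolding ratfun_value_def by (intro exI[of _ "[:c:]"] exI[of _ 1]) simp

lemma ratfun_value_one: "ratfun_value 1 a 1"
  using ratfun_value_const[of 1 a] by (simp add: One_fract_def one_pCons)

lemma ratfun_value_add:
  assumes "ratfun_value \<phi> a y" and "ratfun_value \<psi> a z"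
  shows "ratfun_value (\<phi> + \<psi>) a (y + z)"
proof -
  obtain p q where 1: "\<phi> = Fraction_Field.Fract p q" "poly q a \<noteq> 0" "y = poly p a / poly q a"
    using assms(1) unfolding ratfun_value_def by blast
  obtain r s where 2: "\<psi> = Fraction_Field.Fract r s" "poly s a \<noteq> 0" "z = poly r a / poly s a"
    using assms(2) unfolding ratfun_value_def by blast
  have "q \<noteq> 0" "s \<noteq> 0" using 1 2 by auto
  then show ?thesis
    unfolding ratfun_value_def using 1 2
    by (intro exI[of _ "p * s + r * q"] exI[of _ "q * s"]) (simp add: add_frac_eq)
qed

lemma ratfun_value_mult:
  assumes "ratfun_value \<phi> a y" and "ratfun_value \<psi> a z"
  shows "ratfun_value (\<phi> * \<psi>) a (y * z)"
proof -
  obtain p q where 1: "\<phi> = Fraction_Field.Fract p q" "poly q a \<noteq> 0" "y = poly p a / poly q a"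
    using assms(1) unfolding ratfun_value_def by blast
  obtain r s where 2: "\<psi> = Fraction_Field.Fract r s" "poly s a \<noteq> 0" "z = poly r a / poly s a"
    using assms(2) unfolding ratfun_value_def by blast
  show ?thesis
    unfolding ratfun_value_def using 1 2
    by (intro exI[of _ "p * r"] exI[of _ "q * s"]) auto
qed

text \<open>A nonzero value means that the numerator does not vanish at \<open>a\<close>, so
  numerator and denominator can be exchanged.\<close>

lemma ratfun_value_inverse:
  assumes "ratfun_value \<phi> a y" and "y \<noteq> 0"
  shows "ratfun_value (inverse \<phi>) a (inverse y)"
proof -
  obtain p q where 1: "\<phi> = Fraction_Field.Fract p q" "poly q a \<noteq> 0" "y = poly p a / poly q a"
    using assms(1) unfolding ratfun_value_def by blast
  then show ?thesis
    unfolding ratfun_value_def using assms(2)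
    by (intro exI[of _ q] exI[of _ p]) auto
qed

text \<open>The result is unspecified where \<open>\<phi>\<close> has a pole.\<close>

definition ratfun_eval :: "'k::field \<Rightarrow> 'k poly fract \<Rightarrow> 'k" where
  "ratfun_eval a \<phi> = (THE y. ratfun_value \<phi> a y)"

lemma ratfun_eval_eq: "ratfun_value \<phi> a y \<Longrightarrow> ratfun_eval a \<phi> = y"
  unfolding ratfun_eval_def using ratfun_value_unique by blast

text \<open>Stated for any subring of functions defined at \<open>a\<close>, to cover both the ring
  of integer-valued rational functions and its overring \<open>T\<close>.\<close>

lemma field_subring_hom_ratfun_eval:
  assumes "subdomain A ring_of_type_algebra" and "\<And>\<phi>. \<phi> \<in> A \<Longrightarrow> \<exists>y. ratfun_value \<phi> a y"
  shows "field_subring_hom A (ratfun_eval a)"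
proof (intro field_subring_hom.intro field_subring.intro field_subring_hom_axioms.intro)
  have eval: "ratfun_value \<phi> a (ratfun_eval a \<phi>)" if "\<phi> \<in> A" for \<phi>
    using assms(2) that ratfun_eval_eq by blast
  fix \<phi> \<psi> assume "\<phi> \<in> A" "\<psi> \<in> A"
  then show "ratfun_eval a (\<phi> + \<psi>) = ratfun_eval a \<phi> + ratfun_eval a \<psi>"
    "ratfun_eval a (\<phi> * \<psi>) = ratfun_eval a \<phi> * ratfun_eval a \<psi>"
    by (simp_all add: ratfun_eval_eq ratfun_value_add ratfun_value_mult eval)
next
  show "ratfun_eval a 1 = 1"
    using ratfun_value_one by (rule ratfun_eval_eq)
qed (rule assms(1))

text \<open>The constants from \<open>D\<close> are integer-valued, so every element of
  \<open>D\<close> is attained.\<close>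

lemma ratfun_eval_image_Int_R:
  assumes "a \<in> E"
  shows "ratfun_eval a ` Int_R E D = D"
proof
  show "ratfun_eval a ` Int_R E D \<subseteq> D"
    using assms ratfun_eval_eq by (fastforce simp: Int_R_def)
  show "D \<subseteq> ratfun_eval a ` Int_R E D"
  proof
    fix d assume "d \<in> D"
    then have "Fraction_Field.Fract [:d:] 1 \<in> Int_R E D"
      using ratfun_value_const by (auto simp: Int_R_def)
    then show "d \<in> ratfun_eval a ` Int_R E D"
      using ratfun_eval_eq[OF ratfun_value_const] by (metis image_eqI)
  qed
qed

theorem proposition1p7:
  fixes D E :: "'k::field set"
  assumes "subdomain D ring_of_type_algebra"
    and "\<forall>x. \<exists>a\<in>D. \<exists>b\<in>D. b \<noteq> 0 \<and> x = a / b"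
    and "E \<noteq> {}"
    and "gpvd (Int_R E D)"
  shows "gpvd D"
proof -
  let ?R = "Int_R E D"
  obtain a where a: "a \<in> E"
    using assms(3) by blast
  obtain T J where R: "subdomain ?R ring_of_type_algebra" and T: "pruefer_domain T"
    and unibr: "unibranched ?R T" and JR: "radical_ideal J ?R" and JT: "radical_ideal J T"
    and maxT: "\<And>P. primeideal P (ring_on T) \<Longrightarrow> J \<subseteq> P \<Longrightarrow> maximalideal P (ring_on T)"
    and maxR: "\<And>P. primeideal P (ring_on ?R) \<Longrightarrow> J \<subseteq> P \<Longrightarrow> maximalideal P (ring_on ?R)"
    using assms(4) unfolding gpvd_def by blast
  have R_value: "\<exists>y. ratfun_value \<phi> a y" if "\<phi> \<in> ?R" for \<phi>
    using that a by (auto simp: Int_R_def)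
  interpret R: field_subring_hom ?R "ratfun_eval a"
    using R R_value by (rule field_subring_hom_ratfun_eval)
  have T_dom: "subdomain T ring_of_type_algebra"
    using T by (simp add: pruefer_domain_def)
  interpret T: field_subring T
    by (rule field_subring.intro) (rule T_dom)
  have JsubR: "J \<subseteq> ?R"
    using JR unfolding radical_ideal_def R.ideal_iff by blast
  show ?thesis
  proof (cases "\<forall>j\<in>J. ratfun_eval a j = 0")
    case False
    then obtain j where j: "j \<in> J" "ratfun_eval a j \<noteq> 0" by blast
    then obtain y where y: "ratfun_value j a y" "y \<noteq> 0"
      using JsubR R_value ratfun_eval_eq by blast
    have "j \<noteq> 0"
      using j(2) R.hom_zero by auto
    have "\<exists>z. ratfun_value t a z" if "t \<in> T" for t
    proof -
      have "t * j \<in> ?R"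
        using that j(1) JT JsubR unfolding radical_ideal_def T.ideal_iff by blast
      then obtain w where "ratfun_value (t * j) a w"
        using R_value by blast
      \<comment> \<open>As \<open>y \<noteq> 0\<close>, \<open>inverse j\<close> has no pole at
        \<open>a\<close>, so neither does \<open>t\<close>.\<close>
      then have "ratfun_value (t * j * inverse j) a (w * inverse y)"
        using ratfun_value_mult ratfun_value_inverse y by blast
      then show ?thesis
        using \<open>j \<noteq> 0\<close> by (auto simp: mult.assoc)
    qed
    then have "field_subring_hom T (ratfun_eval a)"
      using T_dom by (intro field_subring_hom_ratfun_eval)
    then have "gpvd (ratfun_eval a ` ?R)"
      using R T unibr JR JT maxT maxR j by (rule field_subring_hom_gpvd_image)
    then show ?thesis
      by (simp add: ratfun_eval_image_Int_R[OF a])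
  next
    case True
    \<comment> \<open>The zero ideal of \<open>D\<close> is prime, and its preimage is the kernel of
      evaluation, which contains \<open>J\<close> in this case. So the kernel is maximal, and hence
      so is the zero ideal, which means that \<open>D\<close> is a field.\<close>
    have "primeideal {0} (ring_on (ratfun_eval a ` ?R))"
      unfolding R.image.primeideal_iff R.image.ideal_iff using R.image.zero_mem by auto
    then have "maximalideal {\<phi> \<in> ?R. ratfun_eval a \<phi> \<in> {0}} (ring_on ?R)"
      using True JsubR by (intro maxR R.primeideal_preimage) auto
    then have "maximalideal {0} (ring_on (ratfun_eval a ` ?R))"
      using \<open>primeideal {0} _\<close> by (intro R.maximalideal_of_preimage)
    then have *: "\<forall>x\<in>D - {0}. \<exists>u\<in>D. 1 - x * u \<in> {0}"
      unfolding R.image.maximalideal_iff unfolding ratfun_eval_image_Int_R[OF a] by blast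
    have "inverse x \<in> D" if x: "x \<in> D" for x
    \<comment> \<open>For \<open>x = 0\<close> the convention \<open>inverse 0 = 0\<close> gives the
      claim.\<close>
    proof (cases "x = 0")
      case False
      then obtain u where "u \<in> D" "x * u = 1"
        using * x by auto
      then show ?thesis
        by (metis inverse_unique)
    qed (use x in simp)
    then show ?thesis
      using assms(1) by (rule gpvd_subfield[rotated])
  qed
qed

end
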